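(* There exists a quaternary Hermitian LCD $[n,k,d]$ code for each of the following $(n,k,d)$: $(27,6,15)$, $(27,8,13)$, $(27,9,12)$, $(27,11,10)$, $(28,11,11)$, $(29,11,11)$, $(30,7,16)$, $(30,12,11)$.
   Context: A quaternary $[n,k]$ code is a $k$-dimensional subspace $C$ of $\mathbb{F}_4^n$. The minimum weight of $C$ is the smallest number of nonzero coordinates of a nonzero codeword; an $[n,k,d]$ code is an $[n,k]$ code with minimum weight $d$. For $a\in\mathbb{F}_4$, $\overline{a}=a^2$. The Hermitian inner product of $u,v\in\mathbb{F}_4^n$ is $(u,v)_h=\sum_{j=1}^n u_j\overline{v_j}$, and $C^{\perp h}=\{u\in\mathbb{F}_4^n\mid (u,v)_h=0\text{ for all }v\in C\}$. $C$ is a Hermitian LCD code if $C\cap C^{\perp h}=\{0\}$. *)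

theory Defs
  imports "HOL-Analysis.Cartesian_Space" "HOL-Library.Numeral_Type"
begin

text \<open>The field of order 4: 0, 1, \<open>\<omega>\<close> and \<open>\<omega>\<^sup>2 = \<omega> + 1\<close>.\<close>

datatype gf4 = Zero | One | Omega | Omega2

lemma UNIV_gf4: "(UNIV :: gf4 set) = {Zero, One, Omega, Omega2}"
proof -
  have "x \<in> {Zero, One, Omega, Omega2}" for x :: gf4
    by (cases x) auto
  then show ?thesis by blast
qed

instance gf4 :: finite
  by standard (simp add: UNIV_gf4)

lemma CARD_gf4: "CARD(gf4) = 4"
  by (simp add: UNIV_gf4)

instantiation gf4 :: field
begin

definition zero_gf4 :: gf4 where "0 = Zero"

definition one_gf4 :: gf4 where "1 = One"

fun plus_gf4 :: "gf4 \<Rightarrow> gf4 \<Rightarrow> gf4" where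
  "Zero + b = b"
| "a + Zero = a"
| "One + One = Zero"
| "One + Omega = Omega2"
| "One + Omega2 = Omega"
| "Omega + One = Omega2"
| "Omega + Omega = Zero"
| "Omega + Omega2 = One"
| "Omega2 + One = Omega"
| "Omega2 + Omega = One"
| "Omega2 + Omega2 = Zero"

definition uminus_gf4 :: "gf4 \<Rightarrow> gf4" where "- a = (a :: gf4)"

definition minus_gf4 :: "gf4 \<Rightarrow> gf4 \<Rightarrow> gf4" where "a - b = a + (b :: gf4)"

fun times_gf4 :: "gf4 \<Rightarrow> gf4 \<Rightarrow> gf4" where
  "Zero * b = Zero"
| "One * b = b"
| "a * Zero = Zero"
| "a * One = a"
| "Omega * Omega = Omega2"
| "Omega * Omega2 = One"
| "Omega2 * Omega = One"
| "Omega2 * Omega2 = Omega"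

fun inverse_gf4 :: "gf4 \<Rightarrow> gf4" where
  "inverse Zero = Zero"
| "inverse One = One"
| "inverse Omega = Omega2"
| "inverse Omega2 = Omega"

definition divide_gf4 :: "gf4 \<Rightarrow> gf4 \<Rightarrow> gf4" where "a div b = a * inverse (b :: gf4)"

instance
proof
  fix a b c :: gf4
  show "a * b * c = a * (b * c)" by (cases a; cases b; cases c) simp_all
  show "a * b = b * a" by (cases a; cases b) simp_all
  show "1 * a = a" by (simp add: one_gf4_def)
  show "a + b + c = a + (b + c)" by (cases a; cases b; cases c) simp_all
  show "a + b = b + a" by (cases a; cases b) simp_all
  show "0 + a = a" by (simp add: zero_gf4_def)
  show "- a + a = 0" by (cases a) (simp_all add: uminus_gf4_def zero_gf4_def)
  show "a - b = a + - b" by (simp add: minus_gf4_def uminus_gf4_def)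
  show "(a + b) * c = a * c + b * c" by (cases a; cases b; cases c) simp_all
  show "(0 :: gf4) \<noteq> 1" by (simp add: zero_gf4_def one_gf4_def)
  show "a \<noteq> 0 \<Longrightarrow> inverse a * a = 1" by (cases a) (simp_all add: zero_gf4_def one_gf4_def)
  show "a div b = a * inverse b" by (simp add: divide_gf4_def)
  show "inverse (0 :: gf4) = 0" by (simp add: zero_gf4_def)
qed

end

definition gf4_conj :: "gf4 \<Rightarrow> gf4" where
  "gf4_conj a = a ^ 2"

definition hermitian_inner :: "gf4 ^ 'n \<Rightarrow> gf4 ^ 'n \<Rightarrow> gf4" where
  "hermitian_inner u v = (\<Sum>j\<in>UNIV. u $ j * gf4_conj (v $ j))"

definition hermitian_dual :: "(gf4 ^ 'n) set \<Rightarrow> (gf4 ^ 'n) set" where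
  "hermitian_dual C = {u. \<forall>v\<in>C. hermitian_inner u v = 0}"

definition hamming_weight :: "gf4 ^ 'n \<Rightarrow> nat" where
  "hamming_weight v = card {j. v $ j \<noteq> 0}"

text \<open>Unspecified for \<open>C \<subseteq> {0}\<close>, where the minimum ranges over the empty set.\<close>

definition minimum_weight :: "(gf4 ^ 'n) set \<Rightarrow> nat" where
  "minimum_weight C = Min {hamming_weight v |v. v \<in> C \<and> v \<noteq> 0}"

text \<open>The length of a code is the cardinality of the index type \<open>'n\<close>; in particular
  codes of length 27 live in \<open>gf4 ^ 27\<close>, where \<open>27\<close> is a numeral type.\<close>

definition quaternary_code :: "nat \<Rightarrow> nat \<Rightarrow> (gf4 ^ 'n) set \<Rightarrow> bool" where
  "quaternary_code k d C \<longleftrightarrow> vec.subspace C \<and> vec.dim C = k \<and> minimum_weight C = d"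

definition hermitian_LCD :: "(gf4 ^ 'n) set \<Rightarrow> bool" where
  "hermitian_LCD C \<longleftrightarrow> C \<inter> hermitian_dual C = {0}"

end

theory Submission
  imports Defs
begin

text \<open>Each code is given by a systematic generator matrix \<open>[I | A]\<close>. It is Hermitian LCD because the
  Gram matrix of the generators is nonsingular, which Gaussian elimination decides. If the positions
  \<open>k+1, \<dots>, 2k\<close> form a second information set, a codeword of weight less than \<open>d\<close> has few nonzero
  coordinates on one of the two sets, so it is a combination of few rows of \<open>[I | A]\<close> or of the
  matrix that is systematic in the other set; enumerating these combinations bounds the minimum
  weight from below. A Hermitian LCD \<open>[29,12,11]\<close> code accounts for four of the eight parameters:
  adding a zero coordinate gives \<open>[30,12,11]\<close>, shortening gives \<open>[28,11,11]\<close>, and from the latter a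
  zero coordinate gives \<open>[29,11,11]\<close> and puncturing gives \<open>[27,11,10]\<close>. The matrices come from a
  random search among codes with an automorphism of order 9 (order 3 for \<open>[30,7,16]\<close>).\<close>

section \<open>Linear combinations of lists\<close>

fun vadd :: "'a::field list \<Rightarrow> 'a list \<Rightarrow> 'a list" where
  "vadd (x # xs) (y # ys) = (x + y) # vadd xs ys"
| "vadd _ _ = []"

definition smult :: "'a::field \<Rightarrow> 'a list \<Rightarrow> 'a list" where
  "smult c = map ((*) c)"

text \<open>The length \<open>n\<close> is an argument so that an empty combination is still a zero
  vector of the right length.\<close>

fun lincomb :: "nat \<Rightarrow> 'a::field list \<Rightarrow> 'a list list \<Rightarrow> 'a list" where
  "lincomb n (c # cs) (r # rs) = vadd (smult c r) (lincomb n cs rs)"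
| "lincomb n _ _ = replicate n 0"

fun dot :: "'a::field list \<Rightarrow> 'a list \<Rightarrow> 'a" where
  "dot (x # xs) (y # ys) = x * y + dot xs ys"
| "dot _ _ = 0"

fun wt :: "'a::field list \<Rightarrow> nat" where
  "wt [] = 0"
| "wt (x # xs) = (if x = 0 then wt xs else Suc (wt xs))"

lemma smult_simps [simp]: "smult c [] = []" "smult c (x # xs) = c * x # smult c xs"
  by (simp_all add: smult_def)

lemma length_smult [simp]: "length (smult c xs) = length xs"
  by (simp add: smult_def)

lemma smult_smult: "smult c (smult d xs) = smult (c * d) xs"
  by (induction xs) (simp_all add: mult.assoc)

lemma smult_1 [simp]: "smult 1 xs = xs"
  by (induction xs) simp_all

lemma smult_0: "smult 0 xs = replicate (length xs) 0"
  by (induction xs) simp_all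

lemma smult_replicate_0 [simp]: "smult c (replicate n 0) = replicate n 0"
  by (induction n) simp_all

lemma smult_append [simp]: "smult c (xs @ ys) = smult c xs @ smult c ys"
  by (simp add: smult_def)

lemma take_smult: "take k (smult c xs) = smult c (take k xs)"
  by (simp add: smult_def take_map)

lemma drop_smult: "drop k (smult c xs) = smult c (drop k xs)"
  by (simp add: smult_def drop_map)

lemma length_vadd [simp]: "length (vadd xs ys) = min (length xs) (length ys)"
  by (induction xs ys rule: vadd.induct) simp_all

lemma vadd_assoc: "vadd (vadd xs ys) zs = vadd xs (vadd ys zs)"
proof (induction xs ys arbitrary: zs rule: vadd.induct)
  case (1 x xs y ys)
  then show ?case by (cases zs) (simp_all add: add.assoc)
qed (auto simp: vadd.simps)

lemma vadd_commute: "vadd xs ys = vadd ys xs"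
  by (induction xs ys rule: vadd.induct) (simp_all add: add.commute)

lemma vadd_left_commute: "vadd xs (vadd ys zs) = vadd ys (vadd xs zs)"
  by (metis vadd_assoc vadd_commute)

lemma vadd_0 [simp]: "length xs = n \<Longrightarrow> vadd xs (replicate n 0) = xs"
  by (induction xs arbitrary: n) auto

lemma vadd_0_left [simp]: "length xs = n \<Longrightarrow> vadd (replicate n 0) xs = xs"
  by (metis vadd_0 vadd_commute)

lemma vadd_append:
  "length xs = length us \<Longrightarrow> vadd (xs @ ys) (us @ vs) = vadd xs us @ vadd ys vs"
  by (induction xs us rule: list_induct2) simp_all

lemma take_vadd: "take k (vadd xs ys) = vadd (take k xs) (take k ys)"
  by (induction xs ys arbitrary: k rule: vadd.induct) (simp_all add: take_Cons split: nat.split)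

lemma drop_vadd: "length xs = length ys \<Longrightarrow> drop k (vadd xs ys) = vadd (drop k xs) (drop k ys)"
  by (induction xs ys arbitrary: k rule: list_induct2) (simp_all add: drop_Cons split: nat.split)

lemma smult_vadd: "smult c (vadd xs ys) = vadd (smult c xs) (smult c ys)"
  by (induction xs ys rule: vadd.induct) (simp_all add: distrib_left)

lemma vadd_smult_distrib: "smult (c + d) xs = vadd (smult c xs) (smult d xs)"
  by (induction xs) (simp_all add: distrib_right)

lemma length_lincomb [simp]: "\<forall>r\<in>set rs. length r = n \<Longrightarrow> length (lincomb n cs rs) = n"
  by (induction n cs rs rule: lincomb.induct) auto

lemma lincomb_0:
  "\<forall>r\<in>set rs. length r = n \<Longrightarrow> lincomb n (replicate k 0) rs = replicate n 0"
proof (induction rs arbitrary: k)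
  case (Cons r rs)
  then show ?case by (cases k) (simp_all add: smult_0)
qed simp

lemma lincomb_vadd:
  "\<lbrakk>\<forall>r\<in>set rs. length r = n; length cs = length ds\<rbrakk> \<Longrightarrow>
    lincomb n (vadd cs ds) rs = vadd (lincomb n cs rs) (lincomb n ds rs)"
proof (induction rs arbitrary: cs ds)
  case (Cons r rs)
  show ?case
  proof (cases cs)
    case (Cons c cs')
    with Cons.prems obtain d ds' where "ds = d # ds'" by (cases ds) auto
    with Cons Cons.IH[of cs' ds'] Cons.prems show ?thesis
      by (simp add: vadd_smult_distrib vadd_assoc vadd_left_commute)
  qed (use Cons.prems in simp)
qed simp

lemma lincomb_smult: "lincomb n (smult c cs) rs = smult c (lincomb n cs rs)"
  by (induction n cs rs rule: lincomb.induct) (simp_all add: smult_smult smult_vadd)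

lemma lincomb_map_Cons_0:
  "lincomb (Suc n) cs (map ((#) 0) rs) = 0 # lincomb n cs rs"
  by (induction n cs rs rule: lincomb.induct) simp_all

lemma lincomb_map_tl:
  "\<forall>r\<in>set rs. length r = Suc n \<Longrightarrow> lincomb n cs (map tl rs) = tl (lincomb (Suc n) cs rs)"
proof (induction "Suc n" cs rs rule: lincomb.induct)
  case (1 c cs r rs)
  then obtain x xs where "r = x # xs" by (cases r) auto
  moreover obtain y ys where "lincomb (Suc n) cs rs = y # ys"
    using 1 by (cases "lincomb (Suc n) cs rs") (auto dest: arg_cong[of _ _ length])
  ultimately show ?case using 1 by simp
qed simp_all

text \<open>Used in the Gram matrix argument: a vector orthogonal to the whole code is orthogonal to
  each generator because generators are themselves codewords.\<close>

lemma in_rows_lincomb: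
  "\<lbrakk>\<forall>r\<in>set rs. length r = n; g \<in> set rs\<rbrakk> \<Longrightarrow> \<exists>cs. length cs = length rs \<and> lincomb n cs rs = g"
proof (induction rs)
  case (Cons r rs)
  show ?case
  proof (cases "g = r")
    case True
    with Cons.prems have "lincomb n (1 # replicate (length rs) 0) (r # rs) = g"
      by (simp add: lincomb_0)
    then show ?thesis by (metis length_Cons length_replicate)
  next
    case False
    with Cons obtain cs where "length cs = length rs" "lincomb n cs rs = g" by auto
    moreover have "length g = n" using Cons.prems by auto
    ultimately have "lincomb n (0 # cs) (r # rs) = g"
      using Cons.prems by (simp add: smult_0)
    with \<open>length cs = length rs\<close> show ?thesis by (metis length_Cons)
  qed
qed simp

section \<open>Hamming weight of lists\<close>

lemma wt_append [simp]: "wt (xs @ ys) = wt xs + wt ys"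
  by (induction xs) simp_all

lemma wt_smult: "c \<noteq> 0 \<Longrightarrow> wt (smult c xs) = wt xs"
  by (induction xs) simp_all

lemma wt_le_length: "wt xs \<le> length xs"
  by (induction xs) auto

lemma wt_eq_0_iff: "wt xs = 0 \<longleftrightarrow> xs = replicate (length xs) 0"
  by (induction xs) auto

lemma wt_replicate_0 [simp]: "wt (replicate n 0) = 0"
  by (induction n) simp_all

lemma wt_conv_card: "wt (map f [0..<n]) = card {i. i < n \<and> f i \<noteq> 0}"
proof (induction n)
  case (Suc n)
  have "{i. i < Suc n \<and> f i \<noteq> 0} = {i. i < n \<and> f i \<noteq> 0} \<union> (if f n = 0 then {} else {n})"
    by (auto simp: less_Suc_eq)
  with Suc show ?case by simp
qed simp

section \<open>The bilinear form on lists\<close>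

lemma dot_vadd_left:
  "length xs = length ys \<Longrightarrow> dot (vadd xs ys) zs = dot xs zs + dot ys zs"
proof (induction xs ys arbitrary: zs rule: list_induct2)
  case (Cons x xs y ys)
  then show ?case by (cases zs) (simp_all add: distrib_right)
qed simp

lemma dot_smult_left: "dot (smult c xs) ys = c * dot xs ys"
  by (induction xs ys rule: dot.induct) (simp_all add: distrib_left mult.assoc)

lemma dot_commute: "dot xs ys = dot ys xs"
  by (induction xs ys rule: dot.induct) (simp_all add: mult.commute)

lemma dot_0_right [simp]: "dot xs (replicate n 0) = 0"
proof (induction xs arbitrary: n)
  case (Cons x xs)
  then show ?case by (cases n) simp_all
qed simp

lemma dot_0_left [simp]: "dot (replicate n 0) ys = 0"
  by (simp add: dot_commute[of "replicate n 0"])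

text \<open>Turns orthogonality of a codeword to \<open>g\<close> into a linear equation for its
  coefficients \<open>cs\<close>; with \<open>g\<close> a conjugated generator, the equation has a
  row of the Gram matrix as coefficients.\<close>

lemma dot_lincomb:
  "\<lbrakk>\<forall>r\<in>set rs. length r = n\<rbrakk> \<Longrightarrow>
    dot (lincomb n cs rs) g = dot (map (\<lambda>r. dot r g) rs) cs"
proof (induction rs arbitrary: cs)
  case (Cons r rs)
  then show ?case
    by (cases cs) (auto simp: dot_vadd_left dot_smult_left mult.commute)
qed simp

lemma dot_conv_sum: "dot (map f [0..<n]) (map g [0..<n]) = (\<Sum>i<n. f i * g i)"
proof -
  have "dot xs ys = (\<Sum>i<length xs. xs ! i * ys ! i)" if "length xs = length ys" for xs ys :: "'a list"
    using that by (induction xs ys rule: list_induct2) (simp_all add: sum.lessThan_Suc_shift del: sum.lessThan_Suc)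
  from this[of "map f [0..<n]" "map g [0..<n]"] show ?thesis by simp
qed

section \<open>Nonsingularity by Gaussian elimination\<close>

fun trivial_kernel :: "nat \<Rightarrow> 'a::field list list \<Rightarrow> bool" where
  "trivial_kernel 0 M = True"
| "trivial_kernel (Suc k) M =
    (case find (\<lambda>r. hd r \<noteq> 0) M of
      None \<Rightarrow> False
    | Some p \<Rightarrow> trivial_kernel k (map (\<lambda>r. vadd (smult (- (hd r / hd p)) (tl p)) (tl r)) M))"

text \<open>Clearing the first column with a pivot \<open>p\<close> leaves a system satisfied by the
  tail of \<open>x\<close>, so the tail vanishes by induction and the equation of \<open>p\<close>
  then kills the head. The pivot row stays in the list, where elimination makes it a harmless zero
  row.\<close>

lemma trivial_kernel_sound:
  "\<lbrakk>trivial_kernel k M; \<forall>r\<in>set M. length r = k \<and> dot r x = 0; length x = k\<rbrakk> \<Longrightarrow> x = replicate k 0"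
proof (induction k M arbitrary: x rule: trivial_kernel.induct)
  case (2 k M)
  from "2.prems"(1) obtain p where p: "find (\<lambda>r. hd r \<noteq> 0) M = Some p"
    by (auto split: option.splits)
  then have "p \<in> set M" "hd p \<noteq> 0" by (auto simp: find_Some_iff)
  from "2.prems" obtain x0 xs where x: "x = x0 # xs" "length xs = k" by (cases x) auto
  have row: "hd r * x0 + dot (tl r) xs = 0 \<and> length (tl r) = k" if "r \<in> set M" for r
    using "2.prems"(2) that x by (cases r) auto
  have "xs = replicate k 0"
  proof (rule "2.IH"[OF p])
    show "trivial_kernel k (map (\<lambda>r. vadd (smult (- (hd r / hd p)) (tl p)) (tl r)) M)"
      using "2.prems"(1) p by simp
    show "\<forall>r\<in>set (map (\<lambda>r. vadd (smult (- (hd r / hd p)) (tl p)) (tl r)) M).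
        length r = k \<and> dot r xs = 0"
    proof (intro ballI)
      fix q assume "q \<in> set (map (\<lambda>r. vadd (smult (- (hd r / hd p)) (tl p)) (tl r)) M)"
      then obtain r where "r \<in> set M" and q: "q = vadd (smult (- (hd r / hd p)) (tl p)) (tl r)"
        by auto
      have r: "dot (tl r) xs = - (hd r * x0)" "dot (tl p) xs = - (hd p * x0)"
        using row[OF \<open>r \<in> set M\<close>] row[OF \<open>p \<in> set M\<close>]
        by (simp_all add: eq_neg_iff_add_eq_0 add.commute)
      have "length (tl p) = k" "length (tl r) = k"
        using row \<open>p \<in> set M\<close> \<open>r \<in> set M\<close> by blast+
      with \<open>hd p \<noteq> 0\<close> show "length q = k \<and> dot q xs = 0"
        by (simp add: q dot_vadd_left dot_smult_left r del: length_tl)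
    qed
  qed (use x in simp)
  moreover have "x0 = 0"
    using row[OF \<open>p \<in> set M\<close>] \<open>hd p \<noteq> 0\<close> calculation by simp
  ultimately show ?case using x by simp
qed simp

section \<open>Systematic generator matrices\<close>

fun unit_rows :: "nat \<Rightarrow> 'a::field list list" where
  "unit_rows 0 = []"
| "unit_rows (Suc k) = (1 # replicate k 0) # map ((#) 0) (unit_rows k)"

lemma length_unit_rows [simp]: "length (unit_rows k) = k"
  by (induction k) simp_all

lemma length_in_unit_rows: "u \<in> set (unit_rows k) \<Longrightarrow> length u = k"
  by (induction k arbitrary: u) auto

lemma lincomb_unit_rows: "length cs = k \<Longrightarrow> lincomb k cs (unit_rows k) = cs"
proof (induction k arbitrary: cs)
  case (Suc k)
  then obtain c cs' where "cs = c # cs'" by (cases cs) auto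
  with Suc show ?case by (simp add: lincomb_map_Cons_0)
qed simp

lemma lincomb_append:
  "\<lbrakk>length U = length A; length cs = length A; \<forall>u\<in>set U. length u = k; \<forall>a\<in>set A. length a = r\<rbrakk> \<Longrightarrow>
    lincomb (k + r) cs (map2 (@) U A) = lincomb k cs U @ lincomb r cs A"
proof (induction U A arbitrary: cs rule: list_induct2)
  case (Cons u U a A)
  then obtain c cs' where "cs = c # cs'" by (cases cs) auto
  with Cons show ?case by (simp add: vadd_append)
qed (simp add: replicate_add)

definition systematic :: "'a::field list list \<Rightarrow> 'a list list" where
  "systematic A = map2 (@) (unit_rows (length A)) A"

lemma length_systematic [simp]: "length (systematic A) = length A"
  by (simp add: systematic_def)

lemma length_in_systematic:
  "\<lbrakk>\<forall>a\<in>set A. length a = r; g \<in> set (systematic A)\<rbrakk> \<Longrightarrow> length g = length A + r"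
  by (auto simp: systematic_def length_in_unit_rows elim!: in_set_zipE)

lemma lincomb_systematic:
  "\<lbrakk>\<forall>a\<in>set A. length a = r; length m = length A\<rbrakk> \<Longrightarrow>
    lincomb (length A + r) m (systematic A) = m @ lincomb r m A"
  by (simp add: systematic_def lincomb_append length_in_unit_rows lincomb_unit_rows)

section \<open>Lower bounds for the minimum weight\<close>

text \<open>Only the redundancy part \<open>A\<close> is stored:
  \<open>wt m + wt (lincomb r m A)\<close> is the weight of the codeword of \<open>[I | A]\<close>
  with message \<open>m\<close>.\<close>

definition min_wt_ge :: "nat \<Rightarrow> nat \<Rightarrow> 'a::field list list \<Rightarrow> bool" where
  "min_wt_ge d r A \<longleftrightarrow> (\<forall>a\<in>set A. length a = r) \<and>
    (\<forall>m. length m = length A \<longrightarrow> wt m \<noteq> 0 \<longrightarrow> d \<le> wt m + wt (lincomb r m A))"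

text \<open>A message \<open>m\<close> for \<open>tl A\<close> is the message \<open>0 # m\<close>
  for \<open>A\<close>, with the same weight and the same redundancy.\<close>

lemma min_wt_ge_shorten:
  assumes "min_wt_ge d r A" "A \<noteq> []"
  shows "min_wt_ge d r (tl A)"
  unfolding min_wt_ge_def
proof (intro conjI allI impI)
  from assms obtain a A' where A: "A = a # A'" by (cases A) auto
  have len: "\<forall>a\<in>set A. length a = r" using assms(1) by (simp add: min_wt_ge_def)
  with A show "\<forall>a\<in>set (tl A). length a = r" by simp
  fix m :: "'a list" assume m: "length m = length (tl A)" "wt m \<noteq> 0"
  then have "d \<le> wt (0 # m) + wt (lincomb r (0 # m) A)"
    using assms(1) A unfolding min_wt_ge_def by (metis length_Cons list.sel(3) wt.simps(2))
  with A len show "d \<le> wt m + wt (lincomb r m (tl A))" by (simp add: smult_0)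
qed

text \<open>The deleted coordinate, the first of the redundancy part, carries at most one unit of
  weight.\<close>

lemma min_wt_ge_puncture:
  assumes "min_wt_ge (Suc d) (Suc r) A"
  shows "min_wt_ge d r (map tl A)"
  unfolding min_wt_ge_def
proof (intro conjI allI impI)
  have len: "\<forall>a\<in>set A. length a = Suc r" using assms by (simp add: min_wt_ge_def)
  then show "\<forall>a\<in>set (map tl A). length a = r" by simp
  fix m :: "'a list" assume m: "length m = length (map tl A)" "wt m \<noteq> 0"
  have "wt xs \<le> Suc (wt (tl xs))" for xs :: "'a list" by (cases xs) auto
  note this[of "lincomb (Suc r) m A"]
  moreover have "Suc d \<le> wt m + wt (lincomb (Suc r) m A)"
    using assms m by (simp add: min_wt_ge_def)
  ultimately show "d \<le> wt m + wt (lincomb r m (map tl A))"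
    by (simp add: lincomb_map_tl len)
qed

lemma min_wt_ge_pad: "min_wt_ge d r A \<Longrightarrow> min_wt_ge d (Suc r) (map ((#) 0) A)"
  by (simp add: min_wt_ge_def lincomb_map_Cons_0)

section \<open>Enumerating combinations of few rows, for one or two information sets\<close>

fun dist_ge :: "nat \<Rightarrow> gf4 list \<Rightarrow> gf4 list \<Rightarrow> bool" where
  "dist_ge 0 xs ys = True"
| "dist_ge (Suc n) (x # xs) (y # ys) = (if x = y then dist_ge (Suc n) xs ys else dist_ge n xs ys)"
| "dist_ge (Suc n) _ _ = False"

text \<open>With these equations a step of \<^const>\<open>dist_ge\<close> is a single rewrite, without evaluating an
  equality test; the enumerations below spend most of their time here.\<close>

lemma dist_ge_code [code]:
  "dist_ge 0 xs ys = True"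
  "dist_ge (Suc n) [] ys = False"
  "dist_ge (Suc n) (x # xs) [] = False"
  "dist_ge (Suc n) (Zero # xs) (Zero # ys) = dist_ge (Suc n) xs ys"
  "dist_ge (Suc n) (Zero # xs) (One # ys) = dist_ge n xs ys"
  "dist_ge (Suc n) (Zero # xs) (Omega # ys) = dist_ge n xs ys"
  "dist_ge (Suc n) (Zero # xs) (Omega2 # ys) = dist_ge n xs ys"
  "dist_ge (Suc n) (One # xs) (Zero # ys) = dist_ge n xs ys"
  "dist_ge (Suc n) (One # xs) (One # ys) = dist_ge (Suc n) xs ys"
  "dist_ge (Suc n) (One # xs) (Omega # ys) = dist_ge n xs ys"
  "dist_ge (Suc n) (One # xs) (Omega2 # ys) = dist_ge n xs ys"
  "dist_ge (Suc n) (Omega # xs) (Zero # ys) = dist_ge n xs ys"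
  "dist_ge (Suc n) (Omega # xs) (One # ys) = dist_ge n xs ys"
  "dist_ge (Suc n) (Omega # xs) (Omega # ys) = dist_ge (Suc n) xs ys"
  "dist_ge (Suc n) (Omega # xs) (Omega2 # ys) = dist_ge n xs ys"
  "dist_ge (Suc n) (Omega2 # xs) (Zero # ys) = dist_ge n xs ys"
  "dist_ge (Suc n) (Omega2 # xs) (One # ys) = dist_ge n xs ys"
  "dist_ge (Suc n) (Omega2 # xs) (Omega # ys) = dist_ge n xs ys"
  "dist_ge (Suc n) (Omega2 # xs) (Omega2 # ys) = dist_ge (Suc n) xs ys"
  by simp_all

lemma gf4_add_eq_0_iff: "x + y = 0 \<longleftrightarrow> x = (y :: gf4)"
  by (metis add_eq_0_iff uminus_gf4_def)

text \<open>In characteristic 2 a sum of entries vanishes exactly where the entries agree, so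
  Hamming distance is the weight of the sum.\<close>

lemma dist_ge_sound: "dist_ge n xs ys \<Longrightarrow> n \<le> wt (vadd xs ys)"
  by (induction n xs ys rule: dist_ge.induct) (auto simp: gf4_add_eq_0_iff split: if_splits)

text \<open>The predicate \<open>light_ge b d A s\<close> ranges over \<open>s\<close> plus at most \<open>b + 1\<close> rows of \<open>A\<close>; each row used
  contributes one unit of weight in the systematic part, hence \<open>d - 1\<close> in the recursive calls. The
  innermost level only compares \<open>s\<close> with multiples of a row, stopping after \<open>d\<close> differences.\<close>

fun light_ge :: "nat \<Rightarrow> nat \<Rightarrow> gf4 list list \<Rightarrow> gf4 list \<Rightarrow> bool" where
  "light_ge b d [] s = dist_ge d s (smult 0 s)"
| "light_ge 0 d (a # A) s \<longleftrightarrow>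
    dist_ge (d - 1) s a \<and> dist_ge (d - 1) s (smult Omega a) \<and> dist_ge (d - 1) s (smult Omega2 a) \<and>
    light_ge 0 d A s"
| "light_ge (Suc b) d (a # A) s \<longleftrightarrow>
    light_ge b (d - 1) A (vadd s a) \<and> light_ge b (d - 1) A (vadd s (smult Omega a)) \<and>
    light_ge b (d - 1) A (vadd s (smult Omega2 a)) \<and> light_ge (Suc b) d A s"

lemma light_ge_sound:
  "\<lbrakk>light_ge b d A s; length s = r; \<forall>a\<in>set A. length a = r; length m = length A; wt m \<le> Suc b\<rbrakk> \<Longrightarrow>
    d \<le> wt m + wt (vadd s (lincomb r m A))"
proof (induction b d A s arbitrary: m rule: light_ge.induct)
  case (1 b d s)
  \<comment> \<open>\<open>smult 0 s\<close> is the zero list of matching length, so the distance to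
    it is the weight of \<open>s\<close>.\<close>
  then show ?case using dist_ge_sound[of d s "smult 0 s"] by (simp add: smult_0)
next
  case (2 d a A s)
  from "2.prems" obtain c cs where m: "m = c # cs" "length cs = length A" by (cases m) auto
  show ?case
  proof (cases "c = 0")
    case True
    with 2 m show ?thesis by (simp add: smult_0)
  next
    case False
    \<comment> \<open>The budget is spent: \<open>c\<close> is already the single nonzero entry that
      the bound on \<open>wt m\<close> allows.\<close>
    with "2.prems" m have cs: "cs = replicate (length A) 0" by (simp add: wt_eq_0_iff)
    have "dist_ge (d - 1) s (smult c a)"
      using "2.prems"(1) False by (cases c) (simp_all add: zero_gf4_def flip: one_gf4_def)
    then have "d - 1 \<le> wt (vadd s (smult c a))" by (rule dist_ge_sound)
    moreover have "lincomb r m (a # A) = smult c a" using "2.prems" m cs by (simp add: lincomb_0)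
    ultimately show ?thesis using m cs False by simp
  qed
next
  case (3 b d a A s)
  from "3.prems" obtain c cs where m: "m = c # cs" "length cs = length A" by (cases m) auto
  show ?case
  proof (cases "c = 0")
    case True
    with "3.prems" "3.IH"(4)[of cs] m show ?thesis by (simp add: smult_0)
  next
    case False
    then have "c = 1 \<or> c = Omega \<or> c = Omega2"
      by (cases c) (simp_all add: zero_gf4_def one_gf4_def)
    then have "d - 1 \<le> wt cs + wt (vadd (vadd s (smult c a)) (lincomb r cs A))"
      using "3.prems" "3.IH"(1-3)[of cs] m False by auto
    with m False show ?thesis by (simp add: vadd_assoc)
  qed
qed

text \<open>Up to a scalar the first row used has coefficient 1, so \<open>all_light_ge b d A\<close> covers all
  combinations of at most \<open>b + 2\<close> rows.\<close>

fun all_light_ge :: "nat \<Rightarrow> nat \<Rightarrow> gf4 list list \<Rightarrow> bool" where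
  "all_light_ge b d [] = True"
| "all_light_ge b d (a # A) \<longleftrightarrow> light_ge b (d - 1) A a \<and> all_light_ge b d A"

lemma all_light_ge_sound:
  "\<lbrakk>all_light_ge b d A; \<forall>a\<in>set A. length a = r; length m = length A; wt m \<noteq> 0; wt m \<le> Suc (Suc b)\<rbrakk> \<Longrightarrow>
    d \<le> wt m + wt (lincomb r m A)"
proof (induction b d A arbitrary: m rule: all_light_ge.induct)
  case (2 b d a A)
  from "2.prems" obtain c cs where m: "m = c # cs" "length cs = length A" by (cases m) auto
  show ?case
  proof (cases "c = 0")
    case True
    with 2 m show ?thesis by (simp add: smult_0)
  next
    case False
    \<comment> \<open>Dividing by the leading coefficient preserves both weights; the leading row
      itself pays for the \<open>d - 1\<close> in the call of \<open>light_ge\<close>.\<close>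
    define cs' where "cs' = smult (inverse c) cs"
    have "d - 1 \<le> wt cs' + wt (vadd a (lincomb r cs' A))"
      using "2.prems" m False
      by (intro light_ge_sound) (simp_all add: cs'_def wt_smult)
    moreover have "m = smult c (1 # cs')"
      using m False by (simp add: cs'_def smult_smult)
    then have "lincomb r m (a # A) = smult c (vadd a (lincomb r cs' A))"
      by (simp only: lincomb_smult lincomb.simps smult_1)
    ultimately show ?thesis using m False by (simp add: cs'_def wt_smult)
  qed
qed simp

text \<open>With budget \<open>length A\<close> no message is too heavy, so this is an exhaustive
  enumeration up to scalars, affordable for small dimension.\<close>

lemma min_wt_ge_enumerate:
  assumes "all_light_ge (length A) d A" "\<forall>a\<in>set A. length a = r"
  shows "min_wt_ge d r A"
  unfolding min_wt_ge_def
  by (intro conjI allI impI all_light_ge_sound[OF assms] assms(2)) (simp_all, metis wt_le_length le_SucI)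

text \<open>The relation \<open>swaps r A B\<close> says that the codewords \<open>(m, p', p'')\<close> of \<open>[I | A]\<close>, where \<open>p'\<close> is as
  long as \<open>m\<close>, become codewords \<open>(p', p'', m)\<close> of \<open>[I | B]\<close>.\<close>

definition swaps :: "nat \<Rightarrow> 'a::field list list \<Rightarrow> 'a list list \<Rightarrow> bool" where
  "swaps r A B \<longleftrightarrow> (let k = length A in
    (\<forall>a\<in>set A. length a = r) \<and> (\<forall>b\<in>set B. length b = r) \<and> length B = k \<and> k \<le> r \<and>
    list_all2 (\<lambda>u a. lincomb r (take k a) B = drop k a @ u) (unit_rows k) A)"

lemma swaps_lengths:
  assumes "swaps r A B"
  shows "\<forall>a\<in>set A. length a = r" "\<forall>b\<in>set B. length b = r" "length B = length A" "length A \<le> r"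
  using assms by (simp_all add: swaps_def Let_def)

text \<open>The definition tests only the rows of \<open>A\<close>, that is, unit messages;
  linearity extends the exchange to every message.\<close>

lemma swaps_lincomb:
  assumes "swaps r A B" "length m = length A"
  defines "p \<equiv> lincomb r m A"
  shows "lincomb r (take (length A) p) B = drop (length A) p @ m"
proof -
  note len = swaps_lengths[OF assms(1)]
  define k where "k = length A"
  \<comment> \<open>Generalised from \<open>unit_rows k\<close> to any \<open>U\<close>, with
    \<open>k\<close> fixed: after removing a row the remaining unit rows no longer form an identity
    matrix, so the induction needs arbitrary ones.\<close>
  have "lincomb r (take k (lincomb r m A')) B = drop k (lincomb r m A') @ lincomb k m U"
    if "list_all2 (\<lambda>u a. lincomb r (take k a) B = drop k a @ u) U A'"
      "length m = length A'" "\<forall>u\<in>set U. length u = k" "\<forall>a\<in>set A'. length a = r" for U A' m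
    using that
  proof (induction U A' arbitrary: m rule: list_all2_induct)
    case Nil
    then show ?case
      using len by (simp add: k_def lincomb_0 min_absorb2 flip: replicate_add)
  next
    case (Cons u U a A')
    then obtain c cs where "m = c # cs" by (cases m) auto
    with Cons len show ?case
      by (simp add: take_vadd drop_vadd take_smult drop_smult lincomb_vadd lincomb_smult vadd_append)
  qed
  from this[of "unit_rows k" A m] assms len show ?thesis
    by (simp add: swaps_def Let_def lincomb_unit_rows length_in_unit_rows flip: k_def)
qed

text \<open>\<open>m\<close> and \<open>m'\<close> occupy disjoint positions of the codeword. If
  both are too heavy for their enumerations, they contribute at least \<open>b + 3\<close> and
  \<open>c + 3\<close>, which explains the bound \<open>b + c + 6\<close>.\<close>

lemma min_wt_ge_two_information_sets:
  assumes "swaps r A B" "all_light_ge b d A" "all_light_ge c d B" "d \<le> b + c + 6"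
  shows "min_wt_ge d r A"
  unfolding min_wt_ge_def
proof (intro conjI allI impI)
  note len = swaps_lengths[OF assms(1)]
  note A = assms(2) len(1) and B = assms(3) len(2)
  show "\<forall>a\<in>set A. length a = r" by (fact len)
  fix m :: "gf4 list" assume m: "length m = length A" "wt m \<noteq> 0"
  define p where "p = lincomb r m A"
  define m' where "m' = take (length A) p"
  have "lincomb r m' B = drop (length A) p @ m"
    unfolding m'_def p_def by (intro swaps_lincomb assms m)
  moreover have "p = m' @ drop (length A) p" by (simp add: m'_def)
  then have p: "wt p = wt m' + wt (drop (length A) p)" by (metis wt_append)
  ultimately have eq: "wt m + wt p = wt m' + wt (lincomb r m' B)" by simp
  have "length m' = length B" using len by (simp add: m'_def p_def)
  \<comment> \<open>The enumeration over \<open>B\<close> speaks of nonzero messages only; a zero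
    \<open>m'\<close> would make the whole codeword vanish, and with it \<open>m\<close>.\<close>
  have "wt m' \<noteq> 0"
  proof
    assume "wt m' = 0"
    then have "lincomb r m' B = replicate r 0"
      using B(2) by (metis wt_eq_0_iff lincomb_0)
    with eq \<open>wt m' = 0\<close> m show False by simp
  qed
  consider "wt m \<le> Suc (Suc b)" | "wt m' \<le> Suc (Suc c)" | "Suc (Suc b) < wt m" "Suc (Suc c) < wt m'"
    by linarith
  then have "d \<le> wt m + wt p"
  proof cases
    case 1
    then show ?thesis unfolding p_def by (intro all_light_ge_sound[OF A] m)
  next
    case 2
    then show ?thesis unfolding eq
      by (intro all_light_ge_sound[OF B] \<open>length m' = length B\<close> \<open>wt m' \<noteq> 0\<close>)
  next
    case 3
    with p \<open>d \<le> b + c + 6\<close> show ?thesis by simp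
  qed
  then show "d \<le> wt m + wt (lincomb r m A)" by (simp only: p_def)
qed

section \<open>From matrices to codes\<close>

definition coords :: "'a ^ 'n \<Rightarrow> 'a list" where
  "coords v = map (\<lambda>i. v $ (SOME h. bij_betw h {..<CARD('n)} (UNIV :: 'n set)) i) [0..<CARD('n)]"

text \<open>The index type has no preferred order, so \<open>coords\<close> fixes a numbering by
  choice. Its bijectivity is all that matters, since weight and inner product do not depend on the
  order of coordinates.\<close>

lemma coords_enum:
  obtains h where "bij_betw h {..<CARD('n)} (UNIV :: 'n::finite set)"
    "\<And>v :: 'a ^ 'n. coords v = map (\<lambda>i. v $ h i) [0..<CARD('n)]"
proof -
  have "\<exists>h. bij_betw h {..<CARD('n)} (UNIV :: 'n set)"
    unfolding atLeast0LessThan[symmetric] by (rule ex_bij_betw_nat_finite) simp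
  from someI_ex[OF this] show thesis
    by (rule that) (rule coords_def)
qed

lemma length_coords [simp]: "length (coords (v :: 'a ^ 'n)) = CARD('n)"
  by (simp add: coords_def)

lemma bij_coords: "bij_betw coords (UNIV :: ('a ^ 'n::finite) set) {xs. length xs = CARD('n)}"
proof -
  obtain h where h: "bij_betw h {..<CARD('n)} (UNIV :: 'n set)"
    and co: "\<And>v :: 'a ^ 'n. coords v = map (\<lambda>i. v $ h i) [0..<CARD('n)]"
    by (rule coords_enum) blast
  define g where "g = inv_into {..<CARD('n)} h"
  have hg: "h (g j) = j" "g j < CARD('n)" for j
    using h bij_betw_inv_into_right[OF h, of j] bij_betwE[OF bij_betw_inv_into[OF h]]
    by (auto simp: g_def)
  have gh: "g (h i) = i" if "i < CARD('n)" for i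
    using bij_betw_inv_into_left[OF h] that by (simp add: g_def)
  show ?thesis
  proof (rule bij_betw_byWitness[where f' = "\<lambda>xs. \<chi> j. xs ! g j"])
    show "\<forall>v\<in>UNIV. (\<chi> j. coords v ! g j) = (v :: 'a ^ 'n)"
      by (simp add: co hg vec_eq_iff)
    show "\<forall>xs\<in>{xs. length xs = CARD('n)}. coords (\<chi> j. xs ! g j :: 'a ^ 'n) = xs"
      by (auto simp: co gh intro!: nth_equalityI)
  qed auto
qed

lemma coords_eq_iff [simp]: "coords u = coords v \<longleftrightarrow> u = (v :: 'a ^ 'n::finite)"
  using bij_coords by (auto simp: bij_betw_def inj_def)

lemma coords_surj:
  assumes "length xs = CARD('n::finite)"
  obtains v :: "'a ^ 'n" where "coords v = xs"
proof -
  have "xs \<in> range (coords :: 'a ^ 'n \<Rightarrow> 'a list)"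
    using assms bij_betw_imp_surj_on[OF bij_coords] by blast
  with that show thesis by blast
qed

lemma coords_add: "coords (u + v :: 'a::field ^ 'n) = vadd (coords u) (coords v)"
proof -
  have "map (\<lambda>i. f i + g i) xs = vadd (map f xs) (map g xs)" for f g :: "nat \<Rightarrow> 'a" and xs
    by (induction xs) simp_all
  then show ?thesis by (simp add: coords_def)
qed

lemma coords_smult: "coords (c *s v :: 'a::field ^ 'n) = smult c (coords v)"
  by (simp add: coords_def smult_def)

lemma coords_0: "coords (0 :: 'a::field ^ 'n) = replicate CARD('n) 0"
  by (simp add: coords_def map_replicate_const)

lemma wt_coords: "wt (coords v) = hamming_weight (v :: gf4 ^ 'n::finite)"
proof -
  obtain h where h: "bij_betw h {..<CARD('n)} (UNIV :: 'n set)"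
    and co: "\<And>v :: gf4 ^ 'n. coords v = map (\<lambda>i. v $ h i) [0..<CARD('n)]"
    by (rule coords_enum) blast
  have "h ` {i. i < CARD('n) \<and> v $ h i \<noteq> 0} = {j. v $ j \<noteq> 0}"
  proof (intro equalityI subsetI)
    fix j assume "j \<in> {j. v $ j \<noteq> 0}"
    moreover obtain i where "i < CARD('n)" "j = h i"
      using bij_betw_imp_surj_on[OF h] by blast
    ultimately show "j \<in> h ` {i. i < CARD('n) \<and> v $ h i \<noteq> 0}" by blast
  qed auto
  then have "bij_betw h {i. i < CARD('n) \<and> v $ h i \<noteq> 0} {j. v $ j \<noteq> 0}"
    by (intro bij_betw_subset[OF h]) auto
  then show ?thesis
    by (simp add: co wt_conv_card hamming_weight_def bij_betw_same_card)
qed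

lemma hermitian_inner_coords:
  "hermitian_inner u v = dot (coords u) (map gf4_conj (coords (v :: gf4 ^ 'n::finite)))"
proof -
  obtain h where h: "bij_betw h {..<CARD('n)} (UNIV :: 'n set)"
    and co: "\<And>v :: gf4 ^ 'n. coords v = map (\<lambda>i. v $ h i) [0..<CARD('n)]"
    by (rule coords_enum) blast
  have "hermitian_inner u v = (\<Sum>i<CARD('n). u $ h i * gf4_conj (v $ h i))"
    unfolding hermitian_inner_def by (rule sum.reindex_bij_betw[OF h, symmetric])
  then show ?thesis by (simp add: co dot_conv_sum o_def)
qed

section \<open>The Hermitian LCD code of a checked matrix\<close>

definition gram :: "gf4 list list \<Rightarrow> gf4 list list" where
  "gram G = map (\<lambda>g. map (\<lambda>h. dot h (map gf4_conj g)) G) G"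

text \<open>The message \<open>m\<close> encodes to a codeword whose weight is the intended minimum weight \<open>d\<close>.\<close>

definition LCD_matrix :: "nat \<Rightarrow> nat \<Rightarrow> nat \<Rightarrow> gf4 list list \<Rightarrow> gf4 list \<Rightarrow> bool" where
  "LCD_matrix k d r A m \<longleftrightarrow>
    length A = k \<and> trivial_kernel k (gram (systematic A)) \<and>
    length m = k \<and> wt m + wt (lincomb r m A) = d"

text \<open>Encoding, read through \<open>coords\<close>, is an injective linear map on
  \<open>gf4 ^ 'k\<close>. The auxiliary type \<open>'k\<close> supplies a message space of
  dimension \<open>k\<close>, so the dimension of the range follows from injectivity.\<close>

lemma hermitian_LCD_code_exists:
  assumes "LCD_matrix k d r A m" "min_wt_ge d r A" "d > 0"
    and "CARD('k::finite) = k" "CARD('n::finite) = k + r"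
  shows "\<exists>C :: (gf4 ^ 'n) set. quaternary_code k d C \<and> hermitian_LCD C"
proof -
  let ?k = "length A" and ?n = "length A + r" and ?G = "systematic A"
  have len: "\<forall>a\<in>set A. length a = r" and ker: "trivial_kernel ?k (gram ?G)"
    and m: "length m = ?k" "wt m + wt (lincomb r m A) = d"
    and k: "CARD('k) = ?k" and n: "CARD('n) = ?n" and dim: "k = CARD('k)"
    using assms by (auto simp: LCD_matrix_def min_wt_ge_def)
  have lenG: "\<forall>g\<in>set ?G. length g = ?n" using length_in_systematic[OF len] by blast
  define enc where "enc x = lincomb ?n x ?G" for x
  have len_enc [simp]: "length (enc x) = ?n" for x by (simp add: enc_def lenG)
  have enc: "enc x = x @ lincomb r x A" if "length x = ?k" for x
    using lincomb_systematic[OF len that] by (simp add: enc_def)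
  define f :: "gf4 ^ 'k \<Rightarrow> gf4 ^ 'n" where "f x = inv coords (enc (coords x))" for x
  have f: "coords (f x) = enc (coords x)" for x
    unfolding f_def using bij_coords[where 'a = gf4 and 'n = 'n] n
    by (intro f_inv_into_f) (auto simp: bij_betw_def)
  have lin: "Vector_Spaces.linear (*s) (*s) f"
  proof
    show "f (x + y) = f x + f y" for x y
      unfolding coords_eq_iff[symmetric] f coords_add by (simp add: enc_def lenG lincomb_vadd)
    show "f (c *s x) = c *s f x" for c x
      unfolding coords_eq_iff[symmetric] f coords_smult by (simp add: enc_def lincomb_smult)
  qed
  have wt_f: "hamming_weight (f x) = wt (coords x) + wt (lincomb r (coords x) A)" for x
    using k by (simp add: f enc flip: wt_coords)
  \<comment> \<open>The message is the initial segment of its systematic codeword.\<close>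
  have "inj f"
    by (rule injI) (metis append_eq_append_conv coords_eq_iff enc f k length_coords)
  have f_0: "f x = 0 \<longleftrightarrow> x = 0" for x
    using \<open>inj f\<close> vec.linear_0[OF lin] by (metis injD)
  define C where "C = range f"
  have "vec.subspace C"
    unfolding C_def using vec.linear_subspace_image[OF lin vec.subspace_UNIV] by simp
  moreover have "vec.dim C = CARD('k)"
    unfolding C_def by (subst vec.dim_image_eq[OF lin]) (use \<open>inj f\<close> in \<open>simp_all add: card_cart_basis\<close>)
  moreover have "minimum_weight C = d"
    unfolding minimum_weight_def
  proof (rule Min_eqI)
    show "finite {hamming_weight v |v. v \<in> C \<and> v \<noteq> 0}" by simp
  next
    fix w assume "w \<in> {hamming_weight v |v. v \<in> C \<and> v \<noteq> 0}"
    then obtain x where w: "w = hamming_weight (f x)" and "x \<noteq> 0" by (auto simp: C_def f_0)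
    then have "wt (coords x) \<noteq> 0"
      unfolding wt_eq_0_iff by (metis coords_0 coords_eq_iff length_coords)
    then show "d \<le> w"
      using \<open>min_wt_ge d r A\<close> k by (simp add: w wt_f min_wt_ge_def)
  next
    obtain x :: "gf4 ^ 'k" where x: "coords x = m" using coords_surj m(1) k by metis
    have "hamming_weight (f x) = d" using m by (simp add: wt_f x)
    \<comment> \<open>Positive weight puts the witness among the nonzero codewords over which the
      minimum ranges.\<close>
    moreover from this have "f x \<noteq> 0" using \<open>d > 0\<close> by (auto simp: hamming_weight_def)
    ultimately show "d \<in> {hamming_weight v |v. v \<in> C \<and> v \<noteq> 0}" unfolding C_def by blast
  qed
  moreover have "hermitian_LCD C"
  proof -
    have "x = 0" if orth: "f x \<in> hermitian_dual C" for x
    proof -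
      have "coords x = replicate ?k 0"
      \<comment> \<open>A Gram row fixes the second argument \<open>g\<close> and runs over the
        generators in the first, in which the form is linear. It therefore annihilates the message
        of every codeword orthogonal to \<open>g\<close>.\<close>
      proof (rule trivial_kernel_sound[OF ker])
        show "\<forall>q\<in>set (gram ?G). length q = ?k \<and> dot q (coords x) = 0"
        proof
          fix q assume "q \<in> set (gram ?G)"
          then obtain g where g: "g \<in> set ?G" and q: "q = map (\<lambda>h. dot h (map gf4_conj g)) ?G"
            by (auto simp: gram_def)
          \<comment> \<open>The hypothesis \<open>orth\<close> applies to vectors of the form
            \<open>f y\<close>, so the generator \<open>g\<close> is first written as one.\<close>
          obtain cs where cs: "length cs = ?k" "enc cs = g"
            using in_rows_lincomb[OF lenG g] by (auto simp: enc_def)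
          obtain y :: "gf4 ^ 'k" where "coords y = cs" using coords_surj cs(1) k by metis
          with cs have "coords (f y) = g" by (simp add: f)
          moreover have "hermitian_inner (f x) (f y) = 0"
            using orth by (auto simp: hermitian_dual_def C_def)
          ultimately have "dot (enc (coords x)) (map gf4_conj g) = 0"
            by (simp add: hermitian_inner_coords f)
          then show "length q = ?k \<and> dot q (coords x) = 0"
            by (simp add: q enc_def dot_lincomb[OF lenG])
        qed
      qed (simp add: k)
      then show ?thesis by (metis coords_0 coords_eq_iff k)
    qed
    moreover have "hermitian_inner 0 v = 0" for v :: "gf4 ^ 'n" by (simp add: hermitian_inner_def)
    ultimately show ?thesis
      unfolding hermitian_LCD_def using vec.subspace_0[OF \<open>vec.subspace C\<close>]
      by (auto simp: C_def f_0 hermitian_dual_def)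
  qed
  ultimately show ?thesis unfolding quaternary_code_def dim by blast
qed

section \<open>The matrices\<close>

abbreviation "Z \<equiv> Zero"
abbreviation "I \<equiv> One"
abbreviation "W \<equiv> Omega"
abbreviation "V \<equiv> Omega2"

definition A29 :: "gf4 list list" where
  "A29 = [
    [W, V, Z, Z, I, V, W, Z, W, W, V, I, W, V, V, V, I],
    [V, W, V, Z, Z, Z, I, W, W, I, Z, I, I, I, I, Z, I],
    [Z, W, W, W, I, V, Z, V, I, W, V, V, V, W, Z, Z, Z],
    [Z, I, V, W, I, Z, W, W, V, I, I, W, I, I, W, W, I],
    [Z, I, Z, V, I, I, W, V, Z, W, W, W, V, V, V, V, Z],
    [V, I, I, I, Z, I, V, I, W, V, W, Z, V, W, Z, W, W],
    [I, Z, Z, V, Z, Z, V, W, I, V, I, Z, V, I, W, I, V],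
    [W, Z, I, Z, Z, Z, V, V, W, V, I, V, W, V, Z, I, Z],
    [W, I, I, Z, V, V, V, I, W, Z, V, V, I, Z, V, Z, Z],
    [Z, I, Z, I, I, V, Z, Z, I, V, W, I, W, I, W, Z, V],
    [V, V, I, Z, W, Z, Z, V, I, W, V, I, W, V, Z, Z, V],
    [W, Z, V, I, I, I, W, V, Z, I, W, W, Z, I, I, I, I]]"

text \<open>The code of \<open>A29\<close> made systematic in positions 13 to 24. Its columns are
  the last 5 redundancy coordinates followed by the 12 message coordinates.\<close>

definition B29 :: "gf4 list list" where
  "B29 = [
    [V, I, V, I, Z, W, W, W, W, I, I, W, Z, V, V, I, Z],
    [V, V, V, Z, V, V, I, I, V, W, I, W, I, V, I, W, V],
    [V, W, W, I, I, Z, I, V, W, V, I, Z, I, V, W, V, V],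
    [Z, W, Z, W, V, W, W, Z, V, Z, V, W, Z, W, V, I, I],
    [V, W, I, I, Z, I, Z, W, V, Z, W, Z, V, W, V, Z, V],
    [W, Z, Z, I, W, Z, W, W, Z, W, Z, Z, V, V, I, Z, V],
    [W, Z, V, I, Z, V, I, V, W, W, Z, Z, W, W, Z, I, V],
    [I, W, W, W, W, I, W, W, Z, W, W, W, V, V, V, I, W],
    [I, I, W, Z, I, V, W, W, W, W, Z, I, Z, V, V, V, I],
    [I, W, W, Z, Z, I, V, Z, Z, I, W, V, V, I, Z, Z, V],
    [I, W, V, I, V, V, V, I, V, W, I, W, W, W, V, Z, I],
    [V, I, W, W, W, I, V, W, Z, I, V, Z, I, W, I, Z, W]]"

definition A27_6 :: "gf4 list list" where
  "A27_6 = [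
    [W, W, Z, I, W, I, V, Z, I, Z, W, I, W, V, I, Z, V, Z, W, I, Z],
    [V, I, I, V, I, V, I, W, W, Z, W, W, V, W, W, W, I, W, W, Z, I],
    [W, I, V, I, W, V, I, I, V, V, W, Z, W, Z, W, V, W, Z, Z, I, Z],
    [I, Z, W, W, V, Z, W, I, V, I, W, Z, V, Z, W, Z, W, V, V, Z, Z],
    [Z, I, Z, I, I, V, I, I, V, W, I, W, Z, I, I, Z, Z, V, I, W, W],
    [V, W, I, I, W, V, Z, V, Z, Z, I, I, Z, Z, W, Z, V, V, V, V, W]]"

definition A27_8 :: "gf4 list list" where
  "A27_8 = [
    [I, V, W, W, W, W, W, W, V, I, Z, W, I, W, V, Z, V, W, W],
    [W, V, V, Z, I, V, I, W, W, V, Z, Z, I, W, V, W, V, Z, W],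
    [V, V, W, I, V, I, Z, V, I, W, Z, Z, Z, Z, W, Z, I, Z, V],
    [W, V, Z, I, W, I, V, Z, V, I, W, I, V, W, W, W, I, I, I],
    [I, I, Z, V, W, Z, I, I, V, V, V, W, Z, Z, I, W, W, W, W],
    [Z, Z, I, Z, V, Z, W, I, V, I, W, V, Z, W, I, W, I, I, W],
    [I, I, I, V, W, W, W, V, W, V, W, W, I, W, Z, I, W, I, W],
    [I, I, Z, V, I, V, I, I, I, I, V, I, I, W, I, I, I, I, I]]"

definition A27_9 :: "gf4 list list" where
  "A27_9 = [
    [W, Z, I, W, Z, W, V, V, V, W, V, W, W, V, W, I, Z, Z],
    [W, Z, Z, V, Z, W, V, W, I, V, Z, V, V, W, I, I, W, I],
    [I, I, W, Z, W, I, I, W, W, I, Z, I, W, W, V, Z, V, I],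
    [W, I, W, Z, W, I, W, I, V, W, W, I, W, W, Z, W, Z, Z],
    [V, W, W, I, W, I, Z, Z, I, I, V, V, V, W, I, V, Z, V],
    [Z, Z, W, V, V, V, Z, I, I, W, V, Z, W, W, W, W, W, V],
    [W, W, W, W, I, I, W, I, V, I, Z, V, I, Z, Z, Z, Z, W],
    [I, V, Z, Z, I, I, Z, I, W, W, I, W, W, W, V, Z, W, Z],
    [I, W, Z, V, V, V, I, V, I, I, Z, W, W, V, I, I, W, W]]"

text \<open>The code of \<open>A27_9\<close> made systematic in positions 10 to 18, with columns for
  positions 19 to 27 and then 1 to 9.\<close>

definition B27_9 :: "gf4 list list" where
  "B27_9 = [
    [Z, I, V, W, W, I, W, W, W, W, W, V, W, I, V, W, W, V],
    [V, Z, Z, V, Z, I, Z, V, I, W, V, V, V, V, W, Z, V, I],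
    [Z, V, W, I, Z, W, I, V, V, W, Z, W, I, W, V, Z, V, I],
    [Z, W, I, I, I, Z, I, I, W, I, Z, I, I, V, V, V, V, I],
    [W, W, Z, I, Z, I, Z, Z, V, I, V, Z, W, I, Z, Z, I, W],
    [V, Z, V, W, Z, I, W, W, W, Z, W, W, W, V, W, I, Z, W],
    [Z, Z, I, V, W, I, I, V, Z, Z, V, W, Z, Z, V, I, W, V],
    [I, W, W, I, V, I, I, V, Z, I, Z, W, V, W, W, W, Z, V],
    [Z, Z, Z, Z, W, Z, V, W, Z, W, V, V, W, W, I, V, Z, W]]"

definition A30_7 :: "gf4 list list" where
  "A30_7 = [
    [Z, I, V, Z, I, Z, V, I, W, Z, V, V, Z, I, I, V, I, W, V, I, Z, I, Z],
    [W, W, I, V, V, Z, W, W, Z, W, W, Z, V, V, Z, Z, Z, W, W, W, I, W, I],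
    [V, I, I, W, I, Z, V, V, V, V, Z, W, Z, W, W, Z, V, V, W, W, Z, I, V],
    [V, W, W, V, W, Z, W, I, V, Z, W, V, W, I, V, I, Z, W, W, Z, Z, V, V],
    [W, W, W, V, I, V, I, W, I, V, W, I, V, Z, W, V, Z, Z, I, I, I, V, Z],
    [W, V, W, Z, Z, V, V, W, I, Z, Z, Z, I, I, V, W, I, Z, I, V, V, Z, I],
    [V, I, W, W, V, V, Z, I, Z, Z, I, W, I, Z, I, W, V, I, Z, Z, I, I, V]]"

section \<open>Weight bounds for the five matrices, by evaluation\<close>

lemma A29_swaps: "swaps 17 A29 B29"
  by code_simp

text \<open>Budgets 3 here and 2 for \<open>B29\<close> cover combinations of at most 5 and 4 rows;
  \<open>3 + 2 + 6 = 11\<close> is exactly the required bound.\<close>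

lemma A29_light: "all_light_ge 3 11 A29"
  by code_simp

lemma B29_light: "all_light_ge 2 11 B29"
  by code_simp

lemma A29_min_wt: "min_wt_ge 11 17 A29"
  by (rule min_wt_ge_two_information_sets[OF A29_swaps A29_light B29_light]) simp

lemma A27_9_swaps: "swaps 18 A27_9 B27_9"
  by code_simp

text \<open>Here both budgets are 3, as \<open>3 + 3 + 6 = 12\<close>.\<close>

lemma A27_9_light: "all_light_ge 3 12 A27_9"
  by code_simp

lemma B27_9_light: "all_light_ge 3 12 B27_9"
  by code_simp

lemma A27_9_min_wt: "min_wt_ge 12 18 A27_9"
  by (rule min_wt_ge_two_information_sets[OF A27_9_swaps A27_9_light B27_9_light]) simp

lemma A27_6_light: "all_light_ge (length A27_6) 15 A27_6"
  by code_simp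

lemma A27_6_min_wt: "min_wt_ge 15 21 A27_6"
  using A27_6_light by (rule min_wt_ge_enumerate) code_simp

lemma A27_8_light: "all_light_ge (length A27_8) 13 A27_8"
  by code_simp

lemma A27_8_min_wt: "min_wt_ge 13 19 A27_8"
  using A27_8_light by (rule min_wt_ge_enumerate) code_simp

lemma A30_7_light: "all_light_ge (length A30_7) 16 A30_7"
  by code_simp

lemma A30_7_min_wt: "min_wt_ge 16 23 A30_7"
  using A30_7_light by (rule min_wt_ge_enumerate) code_simp

theorem proposition5p3:
  shows "(\<exists>C :: (gf4 ^ 27) set. quaternary_code 6 15 C \<and> hermitian_LCD C) \<and>
    (\<exists>C :: (gf4 ^ 27) set. quaternary_code 8 13 C \<and> hermitian_LCD C) \<and>
    (\<exists>C :: (gf4 ^ 27) set. quaternary_code 9 12 C \<and> hermitian_LCD C) \<and>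
    (\<exists>C :: (gf4 ^ 27) set. quaternary_code 11 10 C \<and> hermitian_LCD C) \<and>
    (\<exists>C :: (gf4 ^ 28) set. quaternary_code 11 11 C \<and> hermitian_LCD C) \<and>
    (\<exists>C :: (gf4 ^ 29) set. quaternary_code 11 11 C \<and> hermitian_LCD C) \<and>
    (\<exists>C :: (gf4 ^ 30) set. quaternary_code 7 16 C \<and> hermitian_LCD C) \<and>
    (\<exists>C :: (gf4 ^ 30) set. quaternary_code 12 11 C \<and> hermitian_LCD C)"
proof (intro conjI)
  have min28: "min_wt_ge 11 17 (tl A29)"
    \<comment> \<open>Only weight bounds pass from \<open>A29\<close> to the derived matrices; their
      LCD property and attained weights are evaluated separately below.\<close>
    by (rule min_wt_ge_shorten[OF A29_min_wt]) code_simp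
  have min27: "min_wt_ge 10 16 (map tl (tl A29))"
    using min28 by (intro min_wt_ge_puncture) simp
  have min29: "min_wt_ge 11 18 (map ((#) 0) (tl A29))"
    using min_wt_ge_pad[OF min28] by simp
  have min30: "min_wt_ge 11 18 (map ((#) 0) A29)"
    using min_wt_ge_pad[OF A29_min_wt] by simp

  have "LCD_matrix 6 15 21 A27_6
      [I, I, V, V, I, I]" by code_simp
  \<comment> \<open>The numeral types provide the cardinalities; \<open>simp\<close> discharges
    \<open>27 = 6 + 21\<close> and \<open>d > 0\<close>.\<close>
  from hermitian_LCD_code_exists[where 'k = 6 and 'n = 27, OF this A27_6_min_wt]
  show "\<exists>C :: (gf4 ^ 27) set. quaternary_code 6 15 C \<and> hermitian_LCD C" by simp

  have "LCD_matrix 8 13 19 A27_8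
      [I, I, Z, Z, Z, Z, Z, Z]" by code_simp
  from hermitian_LCD_code_exists[where 'k = 8 and 'n = 27, OF this A27_8_min_wt]
  show "\<exists>C :: (gf4 ^ 27) set. quaternary_code 8 13 C \<and> hermitian_LCD C" by simp

  have "LCD_matrix 9 12 18 A27_9
      [I, I, V, W, Z, W, Z, Z, Z]" by code_simp
  from hermitian_LCD_code_exists[where 'k = 9 and 'n = 27, OF this A27_9_min_wt]
  show "\<exists>C :: (gf4 ^ 27) set. quaternary_code 9 12 C \<and> hermitian_LCD C" by simp

  have "LCD_matrix 11 10 16 (map tl (tl A29))
      [I, V, Z, W, Z, Z, Z, Z, Z, W, Z]" by code_simp
  from hermitian_LCD_code_exists[where 'k = 11 and 'n = 27, OF this min27]
  show "\<exists>C :: (gf4 ^ 27) set. quaternary_code 11 10 C \<and> hermitian_LCD C" by simp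

  have "LCD_matrix 11 11 17 (tl A29)
      [I, I, Z, Z, Z, V, Z, Z, Z, Z, Z]" by code_simp
  from hermitian_LCD_code_exists[where 'k = 11 and 'n = 28, OF this min28]
  show "\<exists>C :: (gf4 ^ 28) set. quaternary_code 11 11 C \<and> hermitian_LCD C" by simp

  \<comment> \<open>The message is the one used for length 28, since the added zero coordinate
    contributes no weight.\<close>
  have "LCD_matrix 11 11 18 (map ((#) 0) (tl A29))
      [I, I, Z, Z, Z, V, Z, Z, Z, Z, Z]" by code_simp
  from hermitian_LCD_code_exists[where 'k = 11 and 'n = 29, OF this min29]
  show "\<exists>C :: (gf4 ^ 29) set. quaternary_code 11 11 C \<and> hermitian_LCD C" by simp

  have "LCD_matrix 7 16 23 A30_7
      [I, I, V, I, Z, W, V]" by code_simp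
  from hermitian_LCD_code_exists[where 'k = 7 and 'n = 30, OF this A30_7_min_wt]
  show "\<exists>C :: (gf4 ^ 30) set. quaternary_code 7 16 C \<and> hermitian_LCD C" by simp

  have "LCD_matrix 12 11 18 (map ((#) 0) A29)
      [I, I, Z, W, Z, Z, Z, Z, Z, V, Z, Z]" by code_simp
  from hermitian_LCD_code_exists[where 'k = 12 and 'n = 30, OF this min30]
  show "\<exists>C :: (gf4 ^ 30) set. quaternary_code 12 11 C \<and> hermitian_LCD C" by simp
qed

end
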